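(* Under the minimax paradigm, the random dictator rule $f(\nu)=\nu$ is always the unique optimal aggregation rule: for every $n\ge 1$ and all $\mu,p_1,p_2\in[0,1]$ with $p_1<\frac12<p_2$ and $p_1<\mu<p_2$, it is the unique maximizer of $\min_\pi P(f,\pi)$ over all aggregation rules $f$.
   Context: Setting: given a number of agents $n\ge 1$, a prior $\mu$ and posteriors $p_1,p_2$ as in the claim, an information structure is a probability distribution $\pi$ on $\{0,1\}\times\{L,H\}^n$, the law of $(\omega,s_1,\dots,s_n)$ (state and binary signals of the $n$ agents), such that $\pi(\omega=1)=\mu$ and, for every $i$, both values of $s_i$ have positive probability and $\pi(\omega=1\mid s_i=L)=p_1$, $\pi(\omega=1\mid s_i=H)=p_2$. Let $\nu\in\{0,\frac1n,\dots,1\}$ be the fraction of agents $i$ with $s_i=H$; $\hat\pi_0,\hat\pi_1$ are the conditional laws of $\nu$ given $\omega=0$ and $\omega=1$ under $\pi$. An aggregation rule is a function $f:\{0,\frac1n,\dots,1\}\to[0,1]$ ($f(\nu)$ is the probability that the decision maker guesses $\omega=1$ after observing $\nu$). The probability of a correct guess is $P(f,\pi)=\mu\,\mathbb{E}_{\nu\sim\hat\pi_1}[f(\nu)]+(1-\mu)\,\mathbb{E}_{\nu\sim\hat\pi_0}[1-f(\nu)]$. The minimum $\min_\pi$ is over all information structures with the given $n,\mu,p_1,p_2$. The random dictator rule is $f(\frac kn)=\frac kn$ for $0\le k\le n$.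
   Formalization: Uniqueness is asserted only when n = 1 or when 0 < p_1 and p_2 < 1; for n ≥ 2 with p_1 = 0 or p_2 = 1 the random dictator rule is still optimal but not the unique maximizer (e.g. n = 2, μ = 1/2, p_1 = 0, p_2 = 1, where f(1/2) is arbitrary). *)

theory Defs
  imports "HOL-Probability.Probability"
begin

datatype signal = L | H

text \<open>
  The state is a boolean, with \<open>True\<close> standing for \<open>\<omega> = 1\<close>; the agents are
  \<open>0, \<dots>, n - 1\<close>, and a signal profile is a list of length \<open>n\<close>.
\<close>

definition info_structures :: "nat \<Rightarrow> real \<Rightarrow> real \<Rightarrow> real \<Rightarrow> (bool \<times> signal list) pmf set" where
  "info_structures n \<mu> p1 p2 = {\<pi>.
     set_pmf \<pi> \<subseteq> UNIV \<times> {s. length s = n} \<and>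
     \<P>(x in \<pi>. fst x) = \<mu> \<and>
     (\<forall>i<n.
        0 < \<P>(x in \<pi>. snd x ! i = L) \<and> 0 < \<P>(x in \<pi>. snd x ! i = H) \<and>
        \<P>(x in \<pi>. fst x \<bar> snd x ! i = L) = p1 \<and>
        \<P>(x in \<pi>. fst x \<bar> snd x ! i = H) = p2)}"

definition fraction_H :: "signal list \<Rightarrow> real" where
  "fraction_H s = real (card {i. i < length s \<and> s ! i = H}) / real (length s)"

definition cond_law :: "(bool \<times> signal list) pmf \<Rightarrow> bool \<Rightarrow> real pmf" where
  "cond_law \<pi> b = map_pmf (\<lambda>x. fraction_H (snd x)) (cond_pmf \<pi> {x. fst x = b})"

definition grid :: "nat \<Rightarrow> real set" where
  "grid n = {real k / real n | k. k \<le> n}"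

definition aggregation_rules :: "nat \<Rightarrow> (real \<Rightarrow> real) set" where
  "aggregation_rules n = grid n \<rightarrow>\<^sub>E {0..1}"

definition random_dictator :: "nat \<Rightarrow> real \<Rightarrow> real" where
  "random_dictator n = (\<lambda>\<nu>\<in>grid n. \<nu>)"

definition prob_correct :: "real \<Rightarrow> (real \<Rightarrow> real) \<Rightarrow> (bool \<times> signal list) pmf \<Rightarrow> real" where
  "prob_correct \<mu> f \<pi> =
     \<mu> * measure_pmf.expectation (cond_law \<pi> True) (\<lambda>\<nu>. f \<nu>) +
     (1 - \<mu>) * measure_pmf.expectation (cond_law \<pi> False) (\<lambda>\<nu>. 1 - f \<nu>)"

text \<open>
  The infimum below is a minimum: for \<open>p1 < \<mu> < p2\<close> the information structures form a
  nonempty compact set of distributions on a finite set, and \<open>prob_correct \<mu> f\<close> is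
  continuous on it.
\<close>

definition worst_case :: "nat \<Rightarrow> real \<Rightarrow> real \<Rightarrow> real \<Rightarrow> (real \<Rightarrow> real) \<Rightarrow> real" where
  "worst_case n \<mu> p1 p2 f = (INF \<pi>\<in>info_structures n \<mu> p1 p2. prob_correct \<mu> f \<pi>)"

definition minimax_optimal :: "nat \<Rightarrow> real \<Rightarrow> real \<Rightarrow> real \<Rightarrow> (real \<Rightarrow> real) \<Rightarrow> bool" where
  "minimax_optimal n \<mu> p1 p2 f \<longleftrightarrow>
     f \<in> aggregation_rules n \<and>
     (\<forall>g\<in>aggregation_rules n. worst_case n \<mu> p1 p2 g \<le> worst_case n \<mu> p1 p2 f)"

text \<open>
  The random dictator rule is optimal also for \<open>p1 = 0\<close> or \<open>p2 = 1\<close>, but for \<open>n \<ge> 2\<close> it is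
  then not the only optimal rule, so the theorem asserts uniqueness only when \<open>n = 1\<close> or
  \<open>0 < p1\<close> and \<open>p2 < 1\<close>. If \<open>p1 = 0\<close>, then \<open>\<nu> = 1\<close> almost surely given \<open>\<omega> = 1\<close>, so lowering
  the random dictator rule at interior points of the grid never reduces the probability of
  a correct guess; symmetrically, if \<open>p2 = 1\<close>, then \<open>\<nu> = 0\<close> almost surely given \<open>\<omega> = 0\<close>
  and the rule can be raised there.
\<close>

end

theory Submission imports Defs begin

text \<open>
  Every information structure forces the conditional means of \<open>\<nu>\<close> given each state, so the random
  dictator rule is correct with the same probability under all of them. Conversely, any pair of
  conditional laws of \<open>\<nu>\<close> with these means is realised by an information structure. If all agents
  always agree, only \<open>f 0\<close> and \<open>f 1\<close> matter, and as \<open>p1 < 1/2 < p2\<close> no rule beats the random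
  dictator, while \<open>f 0 = 0\<close> and \<open>f 1 = 1\<close> are necessary for a tie. If such a rule has
  \<open>f (k/n) < k/n\<close>, the adversary moves some mass from \<open>{0, 1}\<close> to \<open>k/n\<close> in state 1, keeping the
  mean; if \<open>f (k/n) > k/n\<close>, it does so in state 0.
\<close>

section \<open>Signal probabilities and conditional means\<close>

text \<open>The only weight \<open>q\<close> compatible with total probability,
  \<open>\<mu> = q * p2 + (1 - q) * p1\<close>: every agent receives \<open>H\<close> with this
  probability.\<close>

definition prob_H :: "real \<Rightarrow> real \<Rightarrow> real \<Rightarrow> real" where
  "prob_H \<mu> p1 p2 = (\<mu> - p1) / (p2 - p1)"

text \<open>By Bayes' rule, the probability that a given agent receives \<open>H\<close> in state
  \<open>b\<close>. As it is the same for all agents, it is also the conditional mean of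
  \<nu>.\<close>

definition mean_H :: "real \<Rightarrow> real \<Rightarrow> real \<Rightarrow> bool \<Rightarrow> real" where
  "mean_H \<mu> p1 p2 b =
     (if b then prob_H \<mu> p1 p2 * p2 / \<mu> else prob_H \<mu> p1 p2 * (1 - p2) / (1 - \<mu>))"

lemma prob_H_bounds:
  assumes "p1 < \<mu>" "\<mu> < p2"
  shows "0 < prob_H \<mu> p1 p2" "prob_H \<mu> p1 p2 < 1"
  using assms by (auto simp: prob_H_def)

lemma prob_H_split:
  assumes "p1 < \<mu>" "\<mu> < p2"
  shows "\<mu> = prob_H \<mu> p1 p2 * p2 + (1 - prob_H \<mu> p1 p2) * p1"
proof -
  have "prob_H \<mu> p1 p2 * (p2 - p1) = \<mu> - p1"
    using assms by (simp add: prob_H_def)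
  then show ?thesis by (simp add: algebra_simps)
qed

text \<open>The four joint probabilities of the state and one signal, each factored once through the
  state and once through the signal.\<close>

lemma mean_H_complement:
  assumes "0 \<le> p1" "p2 \<le> 1" "p1 < \<mu>" "\<mu> < p2"
  shows "\<mu> * (1 - mean_H \<mu> p1 p2 True) = (1 - prob_H \<mu> p1 p2) * p1"
    and "(1 - \<mu>) * (1 - mean_H \<mu> p1 p2 False) = (1 - prob_H \<mu> p1 p2) * (1 - p1)"
    and "\<mu> * mean_H \<mu> p1 p2 True = prob_H \<mu> p1 p2 * p2"
    and "(1 - \<mu>) * mean_H \<mu> p1 p2 False = prob_H \<mu> p1 p2 * (1 - p2)"
proof -
  show H: "\<mu> * mean_H \<mu> p1 p2 True = prob_H \<mu> p1 p2 * p2"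
    "(1 - \<mu>) * mean_H \<mu> p1 p2 False = prob_H \<mu> p1 p2 * (1 - p2)"
    using assms by (auto simp: mean_H_def)
  show "\<mu> * (1 - mean_H \<mu> p1 p2 True) = (1 - prob_H \<mu> p1 p2) * p1"
    "(1 - \<mu>) * (1 - mean_H \<mu> p1 p2 False) = (1 - prob_H \<mu> p1 p2) * (1 - p1)"
    using prob_H_split[OF assms(3,4)] H by (simp_all add: algebra_simps)
qed

text \<open>The strict bounds leave an adversary room to move mass in either state:
  \<open>0 < p1\<close> keeps \<open>L\<close> possible in state 1, and \<open>p2 < 1\<close> keeps
  \<open>H\<close> possible in state 0.\<close>

lemma mean_H_bounds:
  assumes "0 \<le> p1" "p2 \<le> 1" "p1 < \<mu>" "\<mu> < p2"
  shows "0 \<le> mean_H \<mu> p1 p2 b" "mean_H \<mu> p1 p2 b \<le> 1"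
    and "0 < p1 \<Longrightarrow> p2 < 1 \<Longrightarrow> 0 < mean_H \<mu> p1 p2 b"
    and "0 < p1 \<Longrightarrow> p2 < 1 \<Longrightarrow> mean_H \<mu> p1 p2 b < 1"
proof -
  note q = prob_H_bounds[OF assms(3,4)]
  note c = mean_H_complement[OF assms]
  have \<mu>: "0 < \<mu>" "\<mu> < 1" using assms by auto
  show "0 \<le> mean_H \<mu> p1 p2 b" "0 < p1 \<Longrightarrow> p2 < 1 \<Longrightarrow> 0 < mean_H \<mu> p1 p2 b"
    using q \<mu> assms by (auto simp: mean_H_def)
  have "0 \<le> \<mu> * (1 - mean_H \<mu> p1 p2 True)" "0 \<le> (1 - \<mu>) * (1 - mean_H \<mu> p1 p2 False)"
    unfolding c(1,2) using q assms by auto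
  then show "mean_H \<mu> p1 p2 b \<le> 1"
    using \<mu> by (cases b) (auto simp: zero_le_mult_iff)
  assume "0 < p1" "p2 < 1"
  then have "0 < \<mu> * (1 - mean_H \<mu> p1 p2 True)" "0 < (1 - \<mu>) * (1 - mean_H \<mu> p1 p2 False)"
    unfolding c(1,2) using q assms by auto
  then show "mean_H \<mu> p1 p2 b < 1"
    using \<mu> by (cases b) (auto simp: zero_less_mult_iff)
qed

section \<open>What every information structure forces\<close>

lemma signal_neq: "x \<noteq> H \<longleftrightarrow> x = L" "x \<noteq> L \<longleftrightarrow> x = H"
  by (cases x; simp)+

lemma fraction_H_bounds: "0 \<le> fraction_H s" "fraction_H s \<le> 1"
proof -
  have "card {i. i < length s \<and> s ! i = H} \<le> card {..<length s}"
    by (rule card_mono) auto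
  then show "0 \<le> fraction_H s" "fraction_H s \<le> 1"
    by (auto simp: fraction_H_def divide_le_eq_1)
qed

lemma fraction_H_in_grid: "length s = n \<Longrightarrow> fraction_H s \<in> grid n"
proof -
  assume n: "length s = n"
  have "card {i. i < length s \<and> s ! i = H} \<le> card {..<length s}"
    by (rule card_mono) auto
  with n show ?thesis by (auto simp: fraction_H_def grid_def)
qed

lemma fraction_H_eq_mean:
  assumes "length s = n"
  shows "fraction_H s = (\<Sum>i<n. indicator {s. s ! i = H} s) / real n"
proof -
  have "(\<Sum>i<n. indicator {s. s ! i = H} s) = real (card {i. i < n \<and> s ! i = H})"
    by (simp add: indicator_def sum.If_cases Int_def)
  with assms show ?thesis by (simp add: fraction_H_def)
qed

lemma measure_cond_pmf:
  assumes "set_pmf p \<inter> A \<noteq> {}"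
  shows "measure (cond_pmf p A) B = measure p (A \<inter> B) / measure p A"
proof -
  have "emeasure (measure_pmf p) A \<noteq> 0"
    using assms by (simp add: measure_pmf.emeasure_eq_measure measure_pmf_zero_iff)
  then show ?thesis
    by (simp add: cond_pmf.rep_eq[OF assms] measure_uniform_measure)
qed

text \<open>The posteriors express the mass of state 1 within each signal event. Summing over both
  signals gives a linear equation for the probability of \<open>H\<close>, whose only solution is
  \<open>prob_H\<close>.\<close>

lemma info_structures_marginal:
  assumes \<pi>: "\<pi> \<in> info_structures n \<mu> p1 p2" and i: "i < n" and p: "p1 < \<mu>" "\<mu> < p2"
  shows "measure \<pi> {x. fst x = b \<and> snd x ! i = H} =
    (if b then prob_H \<mu> p1 p2 * p2 else prob_H \<mu> p1 p2 * (1 - p2))"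
proof -
  let ?m = "measure_pmf.prob \<pi>"
  have H: "?m {x. fst x \<and> snd x ! i = H} = p2 * ?m {x. snd x ! i = H}"
    and L: "?m {x. fst x \<and> snd x ! i = L} = p1 * ?m {x. snd x ! i = L}"
    using \<pi> i by (auto simp: info_structures_def cond_prob_def field_simps)
  have "?m {x. fst x} = ?m ({x. fst x \<and> snd x ! i = H} \<union> {x. fst x \<and> snd x ! i = L})"
    by (rule arg_cong[where f = ?m]) (auto simp: signal_neq)
  also have "\<dots> = ?m {x. fst x \<and> snd x ! i = H} + ?m {x. fst x \<and> snd x ! i = L}"
    by (rule measure_pmf.finite_measure_Union) auto
  finally have \<mu>: "\<mu> = p2 * ?m {x. snd x ! i = H} + p1 * ?m {x. snd x ! i = L}"
    using \<pi> H L by (simp add: info_structures_def)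
  have "?m UNIV = ?m ({x. snd x ! i = H} \<union> {x. snd x ! i = L})"
    by (rule arg_cong[where f = ?m]) (auto simp: signal_neq)
  also have "\<dots> = ?m {x. snd x ! i = H} + ?m {x. snd x ! i = L}"
    by (rule measure_pmf.finite_measure_Union) auto
  finally have "?m {x. snd x ! i = L} = 1 - ?m {x. snd x ! i = H}" by simp
  with \<mu> have q: "?m {x. snd x ! i = H} = prob_H \<mu> p1 p2"
    using p by (simp add: prob_H_def field_simps)
  have "?m {x. snd x ! i = H} = ?m ({x. fst x \<and> snd x ! i = H} \<union> {x. \<not> fst x \<and> snd x ! i = H})"
    by (rule arg_cong[where f = ?m]) auto
  also have "\<dots> = ?m {x. fst x \<and> snd x ! i = H} + ?m {x. \<not> fst x \<and> snd x ! i = H}"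
    by (rule measure_pmf.finite_measure_Union) auto
  finally show ?thesis using H q by (cases b) (simp_all add: algebra_simps)
qed

lemma info_structures_state:
  assumes "\<pi> \<in> info_structures n \<mu> p1 p2"
  shows "measure \<pi> {x. fst x = b} = (if b then \<mu> else 1 - \<mu>)"
proof -
  have "measure \<pi> {x. fst x} = \<mu>" using assms by (simp add: info_structures_def)
  moreover have "measure \<pi> {x. \<not> fst x} = 1 - measure \<pi> {x. fst x}"
    using measure_pmf.prob_neg[of \<pi> "\<lambda>x. fst x"] by simp
  ultimately show ?thesis by simp
qed

lemma info_structures_state_possible:
  assumes "\<pi> \<in> info_structures n \<mu> p1 p2" "0 < \<mu>" "\<mu> < 1"
  shows "set_pmf \<pi> \<inter> {x. fst x = b} \<noteq> {}"
  using info_structures_state[OF assms(1), of b] assms(2,3)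
  by (metis (no_types) diff_gt_0_iff_gt less_irrefl measure_pmf_zero_iff)

lemma set_cond_law:
  assumes "\<pi> \<in> info_structures n \<mu> p1 p2" "0 < \<mu>" "\<mu> < 1"
  shows "set_pmf (cond_law \<pi> b) \<subseteq> grid n"
  using assms(1) set_cond_pmf[OF info_structures_state_possible[OF assms, of b]]
  by (auto simp: cond_law_def info_structures_def intro!: fraction_H_in_grid)

text \<open>\<nu> is an average of \<open>n\<close> indicators, so by linearity its mean depends on
  the single-agent marginals alone, however the signals are correlated.\<close>

lemma expectation_cond_law:
  assumes n: "n \<ge> 1" and p: "0 \<le> p1" "p2 \<le> 1" "p1 < \<mu>" "\<mu> < p2"
    and \<pi>: "\<pi> \<in> info_structures n \<mu> p1 p2"
  shows "measure_pmf.expectation (cond_law \<pi> b) (\<lambda>\<nu>. \<nu>) = mean_H \<mu> p1 p2 b"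
proof -
  have \<mu>: "0 < \<mu>" "\<mu> < 1" using p by auto
  note ne = info_structures_state_possible[OF \<pi> \<mu>, of b]
  let ?C = "cond_pmf \<pi> {x. fst x = b}"
  have "measure_pmf.expectation (cond_law \<pi> b) (\<lambda>\<nu>. \<nu>) =
      measure_pmf.expectation ?C (\<lambda>x. fraction_H (snd x))"
    by (simp add: cond_law_def)
  also have "\<dots> = measure_pmf.expectation ?C
      (\<lambda>x. (\<Sum>i<n. indicator {x. snd x ! i = H} x) / real n)"
  proof (rule integral_cong_AE)
    \<comment> \<open>The two sides agree only on profiles of length \<open>n\<close>, hence almost
      everywhere instead of pointwise.\<close>
    show "AE x in measure_pmf ?C. fraction_H (snd x) =
        (\<Sum>i<n. indicator {x. snd x ! i = H} x) / real n"
    proof (rule AE_pmfI)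
      fix x assume "x \<in> set_pmf ?C"
      then have "length (snd x) = n"
        using set_cond_pmf[OF ne] \<pi> by (auto simp: info_structures_def)
      then show "fraction_H (snd x) = (\<Sum>i<n. indicator {x. snd x ! i = H} x) / real n"
        by (simp add: fraction_H_eq_mean indicator_def)
    qed
  qed auto
  also have "\<dots> = (\<Sum>i<n. measure ?C {x. snd x ! i = H}) / real n"
    by (simp add: Bochner_Integration.integral_sum measure_pmf.emeasure_eq_measure)
  also have "\<dots> = (\<Sum>i<n. mean_H \<mu> p1 p2 b) / real n"
  proof -
    have "measure ?C {x. snd x ! i = H} = mean_H \<mu> p1 p2 b" if "i < n" for i
      using info_structures_marginal[OF \<pi> that p(3,4), of b] info_structures_state[OF \<pi>, of b]
      by (auto simp: measure_cond_pmf[OF ne] mean_H_def Int_def)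
    then show ?thesis by simp
  qed
  finally show ?thesis using n by simp
qed

text \<open>The rule is linear in \<nu>, so only the forced conditional means enter and the value is
  the same for every information structure.\<close>

lemma prob_correct_random_dictator:
  assumes n: "n \<ge> 1" and p: "0 \<le> p1" "p2 \<le> 1" "p1 < \<mu>" "\<mu> < p2"
    and \<pi>: "\<pi> \<in> info_structures n \<mu> p1 p2"
  shows "prob_correct \<mu> (random_dictator n) \<pi> =
    \<mu> * mean_H \<mu> p1 p2 True + (1 - \<mu>) * (1 - mean_H \<mu> p1 p2 False)"
proof -
  have \<mu>: "0 < \<mu>" "\<mu> < 1" using p by auto
  have int: "integrable (measure_pmf (cond_law \<pi> b)) (\<lambda>\<nu>. \<nu>)" for b
    by (rule measure_pmf.integrable_const_bound[where B = 1])
      (auto simp: cond_law_def AE_measure_pmf_iff fraction_H_bounds)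
  \<comment> \<open>Off the grid the rule is \<open>undefined\<close>, so it is the identity only on
    the support.\<close>
  have rd: "AE \<nu> in measure_pmf (cond_law \<pi> b). random_dictator n \<nu> = \<nu>" for b
    using set_cond_law[OF \<pi> \<mu>, of b] by (auto simp: AE_measure_pmf_iff random_dictator_def)
  have "measure_pmf.expectation (cond_law \<pi> b) (random_dictator n) =
      measure_pmf.expectation (cond_law \<pi> b) (\<lambda>\<nu>. \<nu>)" for b
    by (rule integral_cong_AE) (use rd[of b] in auto)
  moreover have "measure_pmf.expectation (cond_law \<pi> b) (\<lambda>\<nu>. 1 - random_dictator n \<nu>) =
      measure_pmf.expectation (cond_law \<pi> b) (\<lambda>\<nu>. 1 - \<nu>)" for b
    by (rule integral_cong_AE) (use rd[of b] in auto)
  moreover have "measure_pmf.expectation (cond_law \<pi> b) (\<lambda>\<nu>. 1 - \<nu>) = 1 - mean_H \<mu> p1 p2 b" for b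
    using int[of b] by (simp add: expectation_cond_law[OF n p \<pi>])
  ultimately show ?thesis
    by (simp add: prob_correct_def expectation_cond_law[OF n p \<pi>])
qed

text \<open>Supplies the lower bound without which an infimum of reals cannot be compared with its
  members.\<close>

lemma prob_correct_nonneg:
  assumes "\<pi> \<in> info_structures n \<mu> p1 p2" "0 < \<mu>" "\<mu> < 1" "f \<in> aggregation_rules n"
  shows "0 \<le> prob_correct \<mu> f \<pi>"
proof -
  have "AE \<nu> in measure_pmf (cond_law \<pi> b). 0 \<le> f \<nu> \<and> f \<nu> \<le> 1" for b
  proof (rule AE_pmfI)
    fix \<nu> assume "\<nu> \<in> set_pmf (cond_law \<pi> b)"
    then have "\<nu> \<in> grid n" using set_cond_law[OF assms(1-3), of b] by blast
    then show "0 \<le> f \<nu> \<and> f \<nu> \<le> 1"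
      using assms(4) by (auto simp: aggregation_rules_def dest: PiE_mem)
  qed
  then have "0 \<le> measure_pmf.expectation (cond_law \<pi> True) f"
    "0 \<le> measure_pmf.expectation (cond_law \<pi> False) (\<lambda>\<nu>. 1 - f \<nu>)"
    by (auto intro!: integral_nonneg_AE)
  with assms(2,3) show ?thesis by (simp add: prob_correct_def)
qed

section \<open>Realising prescribed conditional laws\<close>

lemma expectation_bind_bernoulli_pmf:
  fixes h :: "'a \<Rightarrow> real"
  assumes "0 \<le> t" "t \<le> 1" "\<And>b. finite (set_pmf (F b))"
  shows "measure_pmf.expectation (bernoulli_pmf t \<bind> F) h =
    t * measure_pmf.expectation (F True) h + (1 - t) * measure_pmf.expectation (F False) h"
  using assms by (subst pmf_expectation_bind[of UNIV]) (auto simp: UNIV_bool)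

definition joint :: "real \<Rightarrow> (bool \<Rightarrow> signal list pmf) \<Rightarrow> (bool \<times> signal list) pmf" where
  "joint \<mu> D = bernoulli_pmf \<mu> \<bind> (\<lambda>b. map_pmf (Pair b) (D b))"

lemma measure_joint:
  assumes "0 \<le> \<mu>" "\<mu> \<le> 1" "\<And>b. finite (set_pmf (D b))"
  shows "measure (joint \<mu> D) A =
    \<mu> * measure (D True) (Pair True -` A) + (1 - \<mu>) * measure (D False) (Pair False -` A)"
proof -
  have "measure (joint \<mu> D) A = measure_pmf.expectation (joint \<mu> D) (indicator A)"
    by simp
  also have "\<dots> = \<mu> * measure_pmf.expectation (map_pmf (Pair True) (D True)) (indicator A) +
      (1 - \<mu>) * measure_pmf.expectation (map_pmf (Pair False) (D False)) (indicator A)"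
    unfolding joint_def by (rule expectation_bind_bernoulli_pmf) (use assms in auto)
  finally show ?thesis by simp
qed

lemma cond_law_joint:
  assumes "0 < \<mu>" "\<mu> < 1" "\<And>b. finite (set_pmf (D b))"
  shows "cond_law (joint \<mu> D) b = map_pmf fraction_H (D b)"
proof -
  have st: "measure (joint \<mu> D) {x. fst x = b} = (if b then \<mu> else 1 - \<mu>)"
    using assms by (cases b) (auto simp: measure_joint)
  then have "measure (joint \<mu> D) {x. fst x = b} \<noteq> 0"
    using assms(1,2) by auto
  then have ne: "set_pmf (joint \<mu> D) \<inter> {x. fst x = b} \<noteq> {}"
    by (simp add: measure_pmf_zero_iff)
  have "cond_pmf (joint \<mu> D) {x. fst x = b} = map_pmf (Pair b) (D b)"
  proof (rule pmf_eqI)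
    fix x :: "bool \<times> signal list"
    obtain c s where x: "x = (c, s)" by (cases x)
    have pre: "Pair c -` {(d, s)} = (if c = d then {s} else {})" for c d by auto
    have "pmf (joint \<mu> D) (b, s) = (if b then \<mu> else 1 - \<mu>) * pmf (D b) s"
      using assms by (simp add: measure_joint pre flip: measure_pmf_single)
    moreover have "pmf (map_pmf (Pair b) (D b)) (c, s) = (if c = b then pmf (D b) s else 0)"
      using pre[of b c] by (auto simp: pmf_map measure_pmf_single)
    ultimately show "pmf (cond_pmf (joint \<mu> D) {x. fst x = b}) x = pmf (map_pmf (Pair b) (D b)) x"
      using st assms(1,2) by (auto simp: pmf_cond[OF ne] x)
  qed
  then show ?thesis by (simp add: cond_law_def pmf.map_comp comp_def)
qed

text \<open>The constraints on an information structure concern one agent at a time, so the right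
  marginal for each agent in each state suffices.\<close>

lemma joint_in_info_structures:
  assumes p: "0 \<le> p1" "p2 \<le> 1" "p1 < \<mu>" "\<mu> < p2"
    and D: "\<And>b. set_pmf (D b) \<subseteq> {s. length s = n}"
    and m: "\<And>b i. i < n \<Longrightarrow> measure (D b) {s. s ! i = H} = mean_H \<mu> p1 p2 b"
  shows "joint \<mu> D \<in> info_structures n \<mu> p1 p2"
proof -
  have \<mu>: "0 < \<mu>" "\<mu> < 1" using p by auto
  note q = prob_H_bounds[OF p(3,4)] and c = mean_H_complement[OF p]
  have "finite {s :: signal list. length s = n}"
  proof -
    have "(UNIV :: signal set) = {L, H}" by (auto simp: signal_neq)
    then have "finite (UNIV :: signal set)" by (metis finite.emptyI finite_insert)
    then show ?thesis using finite_lists_length_eq[of "UNIV :: signal set" n] by simp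
  qed
  then have fin: "finite (set_pmf (D b))" for b using D finite_subset by blast
  have mL: "measure (D b) {s. s ! i = L} = 1 - mean_H \<mu> p1 p2 b" if "i < n" for b i
  proof -
    have "{s. s ! i = L} = {s. \<not> s ! i = H}" by (auto simp: signal_neq)
    then show ?thesis
      using measure_pmf.prob_neg[of "D b" "\<lambda>s. s ! i = H"] m[OF that, of b] by simp
  qed
  note mj = measure_joint[OF less_imp_le[OF \<mu>(1)] less_imp_le[OF \<mu>(2)] fin]
  have "measure (joint \<mu> D) {x. snd x ! i = H} = prob_H \<mu> p1 p2"
    "measure (joint \<mu> D) {x. snd x ! i = L} = 1 - prob_H \<mu> p1 p2"
    "measure (joint \<mu> D) {x. fst x \<and> snd x ! i = H} = prob_H \<mu> p1 p2 * p2"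
    "measure (joint \<mu> D) {x. fst x \<and> snd x ! i = L} = (1 - prob_H \<mu> p1 p2) * p1" if "i < n" for i
    using c by (simp_all add: mj m[OF that] mL[OF that]) (simp_all add: algebra_simps)
  moreover have "measure (joint \<mu> D) {x. fst x} = \<mu>" by (simp add: mj)
  moreover have "set_pmf (joint \<mu> D) \<subseteq> UNIV \<times> {s. length s = n}"
    using D by (fastforce simp: joint_def)
  ultimately show ?thesis
    using q by (simp add: info_structures_def cond_prob_def)
qed

text \<open>
  Exactly \<open>k\<close> agents receive \<open>H\<close>; a uniformly random shift \<open>j\<close> gives each agent the signal \<open>H\<close> with
  the same probability \<open>k/n\<close>.
\<close>

definition shifted_profile :: "nat \<Rightarrow> nat \<Rightarrow> nat \<Rightarrow> signal list" where
  "shifted_profile n k j = map (\<lambda>i. if (i + j) mod n < k then H else L) [0..<n]"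

text \<open>Adding \<open>j\<close> modulo \<open>n\<close> permutes the residues, so the preimage
  of the first \<open>k\<close> of them has \<open>k\<close> elements.\<close>

lemma card_shifted_less:
  assumes "k \<le> n"
  shows "card {i. i < n \<and> (i + j) mod n < k} = k"
proof (cases "n = 0")
  case False
  have inj: "inj_on (\<lambda>i. (i + j) mod n) {..<n}"
  proof (rule inj_onI)
    fix a b assume "a \<in> {..<n}" "b \<in> {..<n}" "(a + j) mod n = (b + j) mod n"
    then show "a = b"
    proof (induction a b rule: linorder_wlog)
      case (le a b)
      then have "n dvd b - a" using mod_eq_dvd_iff_nat[of "a + j" "b + j" n] by simp
      then show ?case using le by (auto dest: dvd_imp_le)
    qed auto
  qed
  have "(\<lambda>i. (i + j) mod n) ` {..<n} = {..<n}"
    by (rule card_subset_eq) (use False in \<open>auto simp: card_image[OF inj]\<close>)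
  then have "(\<lambda>i. (i + j) mod n) ` {i. i < n \<and> (i + j) mod n < k} = {..<k}"
    using assms by (auto simp: image_iff set_eq_iff) (metis lessThan_iff order_less_le_trans)
  moreover have "inj_on (\<lambda>i. (i + j) mod n) {i. i < n \<and> (i + j) mod n < k}"
    by (rule inj_on_subset[OF inj]) auto
  ultimately show ?thesis by (metis card_image card_lessThan)
qed (use assms in simp)

lemma fraction_H_shifted_profile:
  assumes "k \<le> n"
  shows "fraction_H (shifted_profile n k j) = real k / real n"
proof -
  have "{i. i < n \<and> shifted_profile n k j ! i = H} = {i. i < n \<and> (i + j) mod n < k}"
    by (auto simp: shifted_profile_def split: if_splits)
  then show ?thesis
    using card_shifted_less[OF assms, of j]
    by (simp add: fraction_H_def) (simp add: shifted_profile_def)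
qed

text \<open>\<open>K\<close> is the law of the number of agents receiving \<open>H\<close>.\<close>

definition spread :: "nat \<Rightarrow> nat pmf \<Rightarrow> signal list pmf" where
  "spread n K = K \<bind> (\<lambda>k. map_pmf (shifted_profile n k) (pmf_of_set {..<n}))"

lemma set_spread: "set_pmf (spread n K) \<subseteq> {s. length s = n}"
  by (auto simp: spread_def shifted_profile_def)

lemma map_fraction_H_spread:
  assumes "set_pmf K \<subseteq> {..n}" "n \<ge> 1"
  shows "map_pmf fraction_H (spread n K) = map_pmf (\<lambda>k. real k / real n) K"
proof -
  have "map_pmf fraction_H (spread n K) =
      K \<bind> (\<lambda>k. map_pmf (\<lambda>j. fraction_H (shifted_profile n k j)) (pmf_of_set {..<n}))"
    by (simp add: spread_def map_bind_pmf pmf.map_comp comp_def)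
  also have "\<dots> = K \<bind> (\<lambda>k. return_pmf (real k / real n))"
    using assms by (intro bind_pmf_cong) (auto simp: fraction_H_shifted_profile)
  finally show ?thesis by (simp add: map_pmf_def)
qed

lemma measure_spread:
  assumes K: "set_pmf K \<subseteq> {..n}" and i: "i < n"
  shows "measure (spread n K) {s. s ! i = H} = measure_pmf.expectation K (\<lambda>k. real k / real n)"
proof -
  have "measure (spread n K) {s. s ! i = H} =
      measure_pmf.expectation (spread n K) (indicator {s. s ! i = H})"
    by simp
  also have "\<dots> = (\<Sum>k\<in>{..n}. pmf K k *
      measure (map_pmf (shifted_profile n k) (pmf_of_set {..<n})) {s. s ! i = H})"
    unfolding spread_def using K i
    by (subst pmf_expectation_bind[of "{..n}"]) (auto simp: set_pmf_of_set lessThan_empty_iff)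
  also have "\<dots> = (\<Sum>k\<in>{..n}. pmf K k * (real k / real n))"
  proof (rule sum.cong)
    fix k assume "k \<in> {..n}"
    \<comment> \<open>Agent \<open>i\<close> is now fixed and the shift \<open>j\<close> varies;
      \<open>i + j\<close> is symmetric, so the count over agents also serves as a count over
      shifts.\<close>
    then have "card {j. j < n \<and> (j + i) mod n < k} = k" by (intro card_shifted_less) simp
    moreover have "{..<n} \<inter> shifted_profile n k -` {s. s ! i = H} =
        {j. j < n \<and> (j + i) mod n < k}"
      using i by (auto simp: shifted_profile_def add.commute split: if_splits)
    ultimately show "pmf K k *
        measure (map_pmf (shifted_profile n k) (pmf_of_set {..<n})) {s. s ! i = H} =
        pmf K k * (real k / real n)"
      using i by (subst measure_map_pmf, subst measure_pmf_of_set) auto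
  qed simp
  also have "\<dots> = measure_pmf.expectation K (\<lambda>k. real k / real n)"
    using K by (subst integral_measure_pmf[of "{..n}"]) auto
  finally show ?thesis .
qed

text \<open>Converse of \<open>expectation_cond_law\<close>: the forced means are the only
  restriction on the pair of laws of the count.\<close>

lemma spread_in_info_structures:
  assumes n: "n \<ge> 1" and p: "0 \<le> p1" "p2 \<le> 1" "p1 < \<mu>" "\<mu> < p2"
    and K: "\<And>b. set_pmf (K b) \<subseteq> {..n}"
    and m: "\<And>b. measure_pmf.expectation (K b) (\<lambda>k. real k / real n) = mean_H \<mu> p1 p2 b"
  shows "joint \<mu> (\<lambda>b. spread n (K b)) \<in> info_structures n \<mu> p1 p2"
  using joint_in_info_structures[OF p set_spread] measure_spread[OF K] m by simp

section \<open>Upper bounds on the worst case\<close>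

text \<open>Each admissible pair of count laws is a move of the adversary, and the value it yields
  bounds the infimum.\<close>

lemma worst_case_le:
  assumes n: "n \<ge> 1" and p: "0 \<le> p1" "p2 \<le> 1" "p1 < \<mu>" "\<mu> < p2"
    and K: "\<And>b. set_pmf (K b) \<subseteq> {..n}"
    and m: "\<And>b. measure_pmf.expectation (K b) (\<lambda>k. real k / real n) = mean_H \<mu> p1 p2 b"
    and f: "f \<in> aggregation_rules n"
  shows "worst_case n \<mu> p1 p2 f \<le>
    \<mu> * measure_pmf.expectation (K True) (\<lambda>k. f (real k / real n)) +
    (1 - \<mu>) * (1 - measure_pmf.expectation (K False) (\<lambda>k. f (real k / real n)))"
proof -
  have \<mu>: "0 < \<mu>" "\<mu> < 1" using p by auto
  let ?\<pi> = "joint \<mu> (\<lambda>b. spread n (K b))"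
  have fin: "finite (set_pmf (K b))" for b using K finite_subset by blast
  have "finite (set_pmf (spread n (K b)))" for b
    using fin n by (auto simp: spread_def set_pmf_of_set lessThan_empty_iff)
  then have law: "cond_law ?\<pi> b = map_pmf (\<lambda>k. real k / real n) (K b)" for b
    using \<mu> by (simp add: cond_law_joint map_fraction_H_spread[OF K n])
  have "worst_case n \<mu> p1 p2 f \<le> prob_correct \<mu> f ?\<pi>"
    unfolding worst_case_def
  proof (rule cINF_lower)
    show "bdd_below (prob_correct \<mu> f ` info_structures n \<mu> p1 p2)"
      using prob_correct_nonneg[OF _ \<mu> f] by (auto intro!: bdd_belowI[where m = 0])
    show "?\<pi> \<in> info_structures n \<mu> p1 p2"
      by (rule spread_in_info_structures) (use assms in auto)
  qed
  also have "prob_correct \<mu> f ?\<pi> =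
    \<mu> * measure_pmf.expectation (K True) (\<lambda>k. f (real k / real n)) +
    (1 - \<mu>) * (1 - measure_pmf.expectation (K False) (\<lambda>k. f (real k / real n)))"
    using fin by (simp add: prob_correct_def law integrable_measure_pmf_finite)
  finally show ?thesis .
qed

text \<open>Unanimous signals: all agents receive \<open>H\<close> with probability
  \<open>m\<close>, and all receive \<open>L\<close> otherwise.\<close>

definition extremal_law :: "nat \<Rightarrow> real \<Rightarrow> nat pmf" where
  "extremal_law n m = bernoulli_pmf m \<bind> (\<lambda>c. return_pmf (if c then n else 0))"

lemma set_extremal_law: "set_pmf (extremal_law n m) \<subseteq> {..n}"
  by (auto simp: extremal_law_def)

lemma expectation_extremal_law:
  fixes h :: "nat \<Rightarrow> real"
  assumes "0 \<le> m" "m \<le> 1"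
  shows "measure_pmf.expectation (extremal_law n m) h = m * h n + (1 - m) * h 0"
  using assms by (simp add: extremal_law_def expectation_bind_bernoulli_pmf)

text \<open>The infimum of a constant. The unanimous structure shows that the index set is nonempty,
  as the infimum of an empty set of reals would be unspecified.\<close>

lemma worst_case_random_dictator:
  assumes n: "n \<ge> 1" and p: "0 \<le> p1" "p2 \<le> 1" "p1 < \<mu>" "\<mu> < p2"
  shows "worst_case n \<mu> p1 p2 (random_dictator n) =
    \<mu> * mean_H \<mu> p1 p2 True + (1 - \<mu>) * (1 - mean_H \<mu> p1 p2 False)"
proof -
  have "joint \<mu> (\<lambda>b. spread n (extremal_law n (mean_H \<mu> p1 p2 b))) \<in> info_structures n \<mu> p1 p2"
    by (rule spread_in_info_structures)
      (use assms mean_H_bounds[OF p] set_extremal_law in \<open>auto simp: expectation_extremal_law\<close>)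
  then have "info_structures n \<mu> p1 p2 \<noteq> {}" by blast
  then show ?thesis
    unfolding worst_case_def using prob_correct_random_dictator[OF assms] by simp
qed

text \<open>Under unanimity the posterior is \<open>p1\<close> after all \<open>L\<close> and
  \<open>p2\<close> after all \<open>H\<close>. Guessing 1 in the first case loses
  \<open>1 - 2 * p1\<close>, guessing 0 in the second loses \<open>2 * p2 - 1\<close>.\<close>

lemma worst_case_le_extremal:
  assumes n: "n \<ge> 1" and p: "0 \<le> p1" "p2 \<le> 1" "p1 < \<mu>" "\<mu> < p2"
    and f: "f \<in> aggregation_rules n"
  shows "worst_case n \<mu> p1 p2 f \<le>
    worst_case n \<mu> p1 p2 (random_dictator n)
    - (1 - prob_H \<mu> p1 p2) * (1 - 2 * p1) * f 0
    - prob_H \<mu> p1 p2 * (2 * p2 - 1) * (1 - f 1)"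
proof -
  define m where "m = mean_H \<mu> p1 p2"
  have m01: "0 \<le> m b" "m b \<le> 1" for b using mean_H_bounds[OF p] by (auto simp: m_def)
  have "worst_case n \<mu> p1 p2 f \<le>
    \<mu> * measure_pmf.expectation (extremal_law n (m True)) (\<lambda>k. f (real k / real n)) +
    (1 - \<mu>) * (1 - measure_pmf.expectation (extremal_law n (m False)) (\<lambda>k. f (real k / real n)))"
    by (rule worst_case_le)
      (use assms m01 set_extremal_law in \<open>auto simp: expectation_extremal_law m_def\<close>)
  also have "\<dots> = \<mu> * m True * f 1 + \<mu> * (1 - m True) * f 0 + (1 - \<mu>)
      - (1 - \<mu>) * m False * f 1 - (1 - \<mu>) * (1 - m False) * f 0"
    using n m01 by (simp add: expectation_extremal_law algebra_simps)
  \<comment> \<open>Regrouped around the ideal values \<open>f 0 = 0\<close> and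
    \<open>f 1 = 1\<close>, so that each deviation carries its own penalty.\<close>
  also have "\<dots> = \<mu> * m True + (1 - \<mu>) * (1 - m False)
      - ((1 - \<mu>) * (1 - m False) - \<mu> * (1 - m True)) * f 0
      - (\<mu> * m True - (1 - \<mu>) * m False) * (1 - f 1)"
    by (simp add: algebra_simps)
  also have "\<dots> = worst_case n \<mu> p1 p2 (random_dictator n)
    - (1 - prob_H \<mu> p1 p2) * (1 - 2 * p1) * f 0
    - prob_H \<mu> p1 p2 * (2 * p2 - 1) * (1 - f 1)"
    unfolding worst_case_random_dictator[OF n p] m_def mean_H_complement[OF p]
    by (simp add: algebra_simps)
  finally show ?thesis .
qed

text \<open>Mass \<open>t\<close> sits at \<open>k\<close>, and the remainder is split between
  \<open>0\<close> and \<open>n\<close> so as to restore the mean \<open>m\<close>. Taking the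
  identity for \<open>f\<close> in the formula recovers that mean.\<close>

lemma three_point_law:
  assumes "n \<ge> 1" "k \<le> n" "0 < m" "m < 1"
  obtains K t where "set_pmf K \<subseteq> {..n}" "0 < t"
    "\<And>f :: real \<Rightarrow> real. f 0 = 0 \<Longrightarrow> f 1 = 1 \<Longrightarrow>
      measure_pmf.expectation K (\<lambda>k. f (real k / real n)) = m + t * (f (real k / real n) - real k / real n)"
proof -
  \<comment> \<open>With \<open>t\<close> at most \<open>m\<close> and at most \<open>1 - m\<close>,
    the mean \<open>r\<close> required of the remainder lies between 0 and 1 wherever
    \<open>x\<close> is in the unit interval.\<close>
  define t where "t = min m (1 - m)"
  define x where "x = real k / real n"
  define r where "r = (m - t * x) / (1 - t)"
  have t: "0 < t" "t < 1" "t \<le> m" "t \<le> 1 - m" using assms by (auto simp: t_def)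
  have x: "0 \<le> x" "x \<le> 1" using assms by (auto simp: x_def)
  have "t * x \<le> t" "t * (1 - x) \<le> t" using t x by (auto intro!: mult_left_le)
  then have "0 \<le> m - t * x" "m - t * x \<le> 1 - t"
    using t(3,4) by (auto simp only: right_diff_distrib)
  then have r: "0 \<le> r" "r \<le> 1"
    using t(2) by (simp_all add: r_def)
  have rt: "(1 - t) * r = m - t * x" using t by (simp add: r_def)
  define K where "K = bernoulli_pmf t \<bind> (\<lambda>c. if c then return_pmf k else extremal_law n r)"
  have fin: "finite (set_pmf (if c then return_pmf k else extremal_law n r))" for c
    using finite_subset[OF set_extremal_law] by simp
  show thesis
  proof
    show "set_pmf K \<subseteq> {..n}"
      using set_extremal_law assms(2) by (fastforce simp: K_def split: if_splits)
    show "0 < t" by fact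
    show "measure_pmf.expectation K (\<lambda>k. f (real k / real n)) =
        m + t * (f (real k / real n) - real k / real n)"
      if "f 0 = 0" "f 1 = 1" for f :: "real \<Rightarrow> real"
    proof -
      have "measure_pmf.expectation K (\<lambda>k. f (real k / real n)) = t * f x + (1 - t) * r"
        unfolding K_def using t r that assms(1) fin
        by (subst expectation_bind_bernoulli_pmf) (auto simp: expectation_extremal_law x_def)
      then show ?thesis using rt by (simp add: x_def algebra_simps)
    qed
  qed
qed

lemma worst_case_less:
  assumes n: "n \<ge> 1" and p: "0 < p1" "p2 < 1" "p1 < \<mu>" "\<mu> < p2"
    and f: "f \<in> aggregation_rules n" "f 0 = 0" "f 1 = 1"
    and k: "k \<le> n" "f (real k / real n) \<noteq> real k / real n"
  shows "worst_case n \<mu> p1 p2 f < worst_case n \<mu> p1 p2 (random_dictator n)"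
proof -
  have p': "0 \<le> p1" "p2 \<le> 1" "p1 < \<mu>" "\<mu> < p2" using p by auto
  have \<mu>: "0 < \<mu>" "\<mu> < 1" using p by auto
  define m where "m = mean_H \<mu> p1 p2"
  define d where "d = f (real k / real n) - real k / real n"
  have m01: "0 < m b" "m b < 1" for b using mean_H_bounds[OF p'] p by (auto simp: m_def)
  \<comment> \<open>The state in which extra mass at \<open>k/n\<close> hurts: state 1 if
    \<open>f\<close> lies below the diagonal there, state 0 if above.\<close>
  define b where "b \<longleftrightarrow> d < 0"
  obtain K t where K: "set_pmf K \<subseteq> {..n}" and t: "0 < t" and
    E: "\<And>f :: real \<Rightarrow> real. f 0 = 0 \<Longrightarrow> f 1 = 1 \<Longrightarrow>
      measure_pmf.expectation K (\<lambda>k. f (real k / real n)) =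
        m b + t * (f (real k / real n) - real k / real n)"
    using three_point_law[OF n k(1) m01[of b]] by blast
  \<comment> \<open>Only the law in state \<open>b\<close> is perturbed; the other state keeps
    unanimous signals, on which \<open>f\<close> agrees with the random dictator.\<close>
  define K' where "K' c = (if c = b then K else extremal_law n (m c))" for c
  have E': "measure_pmf.expectation (K' c) (\<lambda>k. g (real k / real n)) =
      m c + (if c = b then t * (g (real k / real n) - real k / real n) else 0)"
    if "g 0 = 0" "g 1 = 1" for c and g :: "real \<Rightarrow> real"
    using E[of g] that n m01[of c] by (auto simp: K'_def expectation_extremal_law less_imp_le)
  have "worst_case n \<mu> p1 p2 f \<le>
    \<mu> * measure_pmf.expectation (K' True) (\<lambda>k. f (real k / real n)) +
    (1 - \<mu>) * (1 - measure_pmf.expectation (K' False) (\<lambda>k. f (real k / real n)))"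
  proof (rule worst_case_le[OF n p' _ _ f(1)])
    show "set_pmf (K' c) \<subseteq> {..n}" for c using K set_extremal_law by (simp add: K'_def)
    \<comment> \<open>The identity also fixes 0 and 1, and its deviation from the diagonal
      vanishes.\<close>
    show "measure_pmf.expectation (K' c) (\<lambda>k. real k / real n) = mean_H \<mu> p1 p2 c" for c
      using E'[of "\<lambda>x. x" c] by (simp add: m_def)
  qed
  also have "\<dots> = worst_case n \<mu> p1 p2 (random_dictator n) +
      (if b then \<mu> * (t * d) else - (1 - \<mu>) * (t * d))"
    unfolding E'[OF f(2,3), folded d_def] worst_case_random_dictator[OF n p']
    by (simp add: m_def algebra_simps)
  also have "\<dots> < worst_case n \<mu> p1 p2 (random_dictator n)"
    using \<mu> t k(2) by (auto simp: b_def d_def mult_less_0_iff zero_less_mult_iff)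
  finally show ?thesis .
qed

theorem mainTheorem5:
  fixes n :: nat and \<mu> p1 p2 :: real
  assumes "n \<ge> 1"
    and "\<mu> \<in> {0..1}" and "p1 \<in> {0..1}" and "p2 \<in> {0..1}"
    and "p1 < 1 / 2" and "1 / 2 < p2"
    and "p1 < \<mu>" and "\<mu> < p2"
  shows "minimax_optimal n \<mu> p1 p2 (random_dictator n) \<and>
    (n = 1 \<or> 0 < p1 \<and> p2 < 1 \<longrightarrow>
      (\<forall>f. minimax_optimal n \<mu> p1 p2 f \<longrightarrow> f = random_dictator n))"
proof (intro conjI impI allI)
  have p: "0 \<le> p1" "p2 \<le> 1" "p1 < \<mu>" "\<mu> < p2" using assms by auto
  note le = worst_case_le_extremal[OF assms(1) p]
  let ?q = "prob_H \<mu> p1 p2"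
  \<comment> \<open>Here \<open>p1 < 1/2 < p2\<close> enters: both penalties for wrong endpoint
    values are strict.\<close>
  have c: "0 < (1 - ?q) * (1 - 2 * p1)" "0 < ?q * (2 * p2 - 1)"
    using prob_H_bounds[OF p(3,4)] assms(5,6) by auto
  have "0 = real 0 / real n" "1 = real n / real n" using assms(1) by auto
  then have grid01: "0 \<in> grid n" "1 \<in> grid n"
    unfolding grid_def by blast+
  have f01: "0 \<le> f 0" "0 \<le> 1 - f 1" if "f \<in> aggregation_rules n" for f
    using that grid01 PiE_mem[of f "grid n" "\<lambda>_. {0..1}"] by (force simp: aggregation_rules_def)+
  have rd: "random_dictator n \<in> aggregation_rules n"
    by (auto simp: random_dictator_def aggregation_rules_def grid_def divide_le_eq_1)
  have "worst_case n \<mu> p1 p2 f \<le> worst_case n \<mu> p1 p2 (random_dictator n)"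
    if "f \<in> aggregation_rules n" for f
  proof -
    have "0 \<le> (1 - ?q) * (1 - 2 * p1) * f 0" "0 \<le> ?q * (2 * p2 - 1) * (1 - f 1)"
      using c f01[OF that] by (auto intro!: mult_nonneg_nonneg[OF less_imp_le])
    with le[OF that] show ?thesis by linarith
  qed
  with rd show "minimax_optimal n \<mu> p1 p2 (random_dictator n)"
    by (simp add: minimax_optimal_def)
  fix f
  assume nondeg: "n = 1 \<or> 0 < p1 \<and> p2 < 1" and "minimax_optimal n \<mu> p1 p2 f"
  then have f: "f \<in> aggregation_rules n"
    and opt: "worst_case n \<mu> p1 p2 (random_dictator n) \<le> worst_case n \<mu> p1 p2 f"
    using rd by (auto simp: minimax_optimal_def)
  have "0 \<le> (1 - ?q) * (1 - 2 * p1) * f 0" "0 \<le> ?q * (2 * p2 - 1) * (1 - f 1)"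
    using c f01[OF f] by (auto intro!: mult_nonneg_nonneg[OF less_imp_le])
  \<comment> \<open>Optimality leaves no room for a loss, so both nonnegative penalties
    vanish.\<close>
  with le[OF f] opt have "(1 - ?q) * (1 - 2 * p1) * f 0 = 0" "?q * (2 * p2 - 1) * (1 - f 1) = 0"
    by linarith+
  then have ends: "f 0 = 0" "f 1 = 1" using c by auto
  \<comment> \<open>For \<open>n = 1\<close> the endpoints exhaust the grid; otherwise any deviation
    would make the worst case strictly smaller.\<close>
  have diag: "f (real k / real n) = real k / real n" if "k \<le> n" for k
    using nondeg
  proof
    assume "n = 1"
    then have "k = 0 \<or> k = 1" using that by auto
    then show ?thesis using ends \<open>n = 1\<close> by auto
  next
    assume "0 < p1 \<and> p2 < 1"
    then show ?thesis
      using worst_case_less[OF assms(1) _ _ p(3,4) f ends that] opt by force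
  qed
  show "f = random_dictator n"
  proof
    fix \<nu>
    show "f \<nu> = random_dictator n \<nu>"
    proof (cases "\<nu> \<in> grid n")
      case True
      then show ?thesis using diag by (auto simp: random_dictator_def grid_def)
    next
      \<comment> \<open>Both functions are extensional, so off the grid both equal
        \<open>undefined\<close>.\<close>
      case False
      then show ?thesis
        using PiE_arb[of f "grid n" _ \<nu>] f by (simp add: random_dictator_def aggregation_rules_def)
    qed
  qed
qed

end
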